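(* Let $D\in\mathbb{R}^{n\times k}$, let $m\ge1$ be an integer, $s>1$, and $g(P)=[\mathrm{tr}((P^{\mathrm T}D)^m)]^s$. (a) For $P\in\mathbb{R}^{n\times k}$ at which $g(P)$ is well defined, $$\mathrm{tr}\Big(P^{\mathrm T}\frac{\partial[\mathrm{tr}((P^{\mathrm T}D)^m)]^s}{\partial P}\Big)=sm\,[\mathrm{tr}((P^{\mathrm T}D)^m)]^s .$$ (b) Let $P\in\mathbb{R}^{n\times k}_{D+}$, $\widehat P\in\mathbb{R}^{n\times k}$, and let $\widetilde P=\widehat PQ$, where $Q\in\mathrm{St}(k,k)$ is an orthonormal polar factor of $\widehat P^{\mathrm T}D$. Then $\widetilde P\in\mathbb{R}^{n\times k}_{D+}$ and $$\mathrm{tr}\Big(\widehat P^{\mathrm T}\frac{\partial[\mathrm{tr}((P^{\mathrm T}D)^m)]^s}{\partial P}\Big)\le[\mathrm{tr}((\widetilde P^{\mathrm T}D)^m)]^s+(sm-1)[\mathrm{tr}((P^{\mathrm T}D)^m)]^s .$$ In particular, $g$ satisfies conditions (1) and (2) of the definition of an atomic function for NPDo with $\mathbb{P}=\mathrm{St}(k,n)_{D+}$, $\alpha=1$ and $\beta=sm-1$, and thus $[\mathrm{tr}((P^{\mathrm T}D)^m)]^s$ for $s>1$ is an atomic function for NPDo.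
   Context: $1\le k\le n$; $\mathrm{St}(k,n)=\{P\in\mathbb{R}^{n\times k}: P^{\mathrm T}P=I_k\}$; $\mathrm{St}(k,n)_{D+}=\{X\in\mathrm{St}(k,n): X^{\mathrm T}D\succeq0\}$; $\mathbb{R}^{n\times k}_{D+}=\{X\in\mathbb{R}^{n\times k}: X^{\mathrm T}D\succeq0\}$; $A\succeq0$ means symmetric positive semidefinite. An orthonormal polar factor of $B\in\mathbb{R}^{k\times k}$ is a $Q\in\mathrm{St}(k,k)$ with $B=Q\Omega$ for some $\Omega\succeq0$. The function $g$ is well defined at $P$ whenever $\mathrm{tr}((P^{\mathrm T}D)^m)\ge0$, in particular on $\mathbb{R}^{n\times k}_{D+}$, and its Euclidean gradient (matrix of partial derivatives) is $\frac{\partial g(P)}{\partial P}=s[\mathrm{tr}((P^{\mathrm T}D)^m)]^{s-1}\frac{\partial\,\mathrm{tr}((P^{\mathrm T}D)^m)}{\partial P}$ (read as $0$ where $\mathrm{tr}((P^{\mathrm T}D)^m)=0$). Atomic function for NPDo: a function $f$ (on a neighborhood of $\mathrm{St}(k,n)$; here, where well defined) for which there are a subset $\mathbb{P}\subseteq\mathrm{St}(k,n)$ and constants $\alpha>0$, $\beta\ge 0$, $\gamma=\alpha+\beta$ such that (1) $\mathrm{tr}\big(P^{\mathrm T}\frac{\partial f(P)}{\partial P}\big)=\gamma f(P)$ for all $P\in\mathbb{P}$; and (2) given $P\in\mathbb{P}$ and $\widehat P\in\mathrm{St}(k,n)$, there exists $Q\in\mathrm{St}(k,k)$ such that $\widetilde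 P=\widehat PQ\in\mathbb{P}$ and $\mathrm{tr}\big(\widehat P^{\mathrm T}\frac{\partial f(P)}{\partial P}\big)\le\alpha f(\widetilde P)+\beta f(P)$. *)

theory Defs
  imports "HOL-Analysis.Analysis"
begin

text \<open>An \<open>n \<times> k\<close> real matrix has type \<open>real ^ 'k ^ 'n\<close>, with \<open>n = CARD('n)\<close>, \<open>k = CARD('k)\<close>.\<close>

definition stiefel :: "(real ^ 'k ^ 'n) set" where
  "stiefel = {P. transpose P ** P = mat 1}"

definition psd :: "real ^ 'k ^ 'k \<Rightarrow> bool" where
  "psd A \<longleftrightarrow> transpose A = A \<and> (\<forall>x. 0 \<le> x \<bullet> (A *v x))"

definition mat_Dplus :: "real ^ 'k ^ 'n \<Rightarrow> (real ^ 'k ^ 'n) set" where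
  "mat_Dplus D = {X. psd (transpose X ** D)}"

definition stiefel_Dplus :: "real ^ 'k ^ 'n \<Rightarrow> (real ^ 'k ^ 'n) set" where
  "stiefel_Dplus D = {X \<in> stiefel. psd (transpose X ** D)}"

definition polar_factor :: "real ^ 'k ^ 'k \<Rightarrow> real ^ 'k ^ 'k \<Rightarrow> bool" where
  "polar_factor Q B \<longleftrightarrow> Q \<in> stiefel \<and> (\<exists>\<Omega>. psd \<Omega> \<and> B = Q ** \<Omega>)"

text \<open>The power operation of type \<open>real ^ 'k ^ 'k\<close> in the library is not the matrix power.\<close>

primrec matpow :: "real ^ 'k ^ 'k \<Rightarrow> nat \<Rightarrow> real ^ 'k ^ 'k" where
  "matpow A 0 = mat 1"
| "matpow A (Suc m) = A ** matpow A m"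

definition euclidean_grad :: "(real ^ 'k ^ 'n \<Rightarrow> real) \<Rightarrow> real ^ 'k ^ 'n \<Rightarrow> real ^ 'k ^ 'n" where
  "euclidean_grad f P = (\<chi> i j. deriv (\<lambda>t. f (P + t *\<^sub>R axis i (axis j 1))) 0)"

text \<open>
  The real power \<open>x\<^sup>s\<close> with exponent \<open>s > 1\<close> is defined for \<open>x \<ge> 0\<close>, and for every \<open>x\<close> if \<open>s\<close>
  is an integer. Outside its domain it is extended by \<open>0\<close>; the library's \<open>x powr s\<close> agrees with
  it for \<open>x \<ge> 0\<close> only. For \<open>s > 1\<close> the extension has derivative \<open>0\<close> at \<open>x = 0\<close>, so that
  \<open>euclidean_grad\<close> of the function \<open>tr_pow D m s\<close> below is \<open>0\<close> where the trace vanishes, even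
  if the domain of that function is not a neighbourhood of the point. Where the trace is nonzero,
  the domain is a neighbourhood of each of its points and the extension does not matter.
\<close>

definition real_pow_dom :: "real \<Rightarrow> real set" where
  "real_pow_dom s = {x. 0 \<le> x \<or> s \<in> \<int>}"

definition real_pow :: "real \<Rightarrow> real \<Rightarrow> real" where
  "real_pow x s = (if 0 \<le> x then x powr s else if s \<in> \<int> then x powi \<lfloor>s\<rfloor> else 0)"

definition tr_pow_dom :: "real ^ 'k ^ 'n \<Rightarrow> nat \<Rightarrow> real \<Rightarrow> (real ^ 'k ^ 'n) set" where
  "tr_pow_dom D m s = {P. trace (matpow (transpose P ** D) m) \<in> real_pow_dom s}"

definition tr_pow :: "real ^ 'k ^ 'n \<Rightarrow> nat \<Rightarrow> real \<Rightarrow> real ^ 'k ^ 'n \<Rightarrow> real" where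
  "tr_pow D m s P = real_pow (trace (matpow (transpose P ** D) m)) s"

text \<open>
  In the following, \<open>U\<close> is the set on which \<open>f\<close> is well defined. Differentiability is what gives
  \<open>euclidean_grad f P\<close> its meaning.
\<close>

definition NPDo_conditions ::
    "(real ^ 'k ^ 'n) set \<Rightarrow> (real ^ 'k ^ 'n \<Rightarrow> real) \<Rightarrow> (real ^ 'k ^ 'n) set \<Rightarrow> real \<Rightarrow> real \<Rightarrow> bool" where
  "NPDo_conditions U f PP \<alpha> \<beta> \<longleftrightarrow>
     PP \<subseteq> stiefel \<and> PP \<subseteq> U \<and> (\<forall>P\<in>PP. f differentiable (at P)) \<and> 0 < \<alpha> \<and> 0 \<le> \<beta> \<and>
     (\<forall>P\<in>PP. trace (transpose P ** euclidean_grad f P) = (\<alpha> + \<beta>) * f P) \<and>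
     (\<forall>P\<in>PP. \<forall>P'\<in>stiefel. \<exists>Q\<in>stiefel.
        P' ** Q \<in> PP \<and>
        trace (transpose P' ** euclidean_grad f P) \<le> \<alpha> * f (P' ** Q) + \<beta> * f P)"

definition NPDo_atomic :: "(real ^ 'k ^ 'n) set \<Rightarrow> (real ^ 'k ^ 'n \<Rightarrow> real) \<Rightarrow> bool" where
  "NPDo_atomic U f \<longleftrightarrow> (\<exists>PP \<alpha> \<beta>. NPDo_conditions U f PP \<alpha> \<beta>)"

end

theory Submission
  imports Defs
begin

text \<open>
  With \<open>h = tr ((P\<^sup>T D)\<^sup>m)\<close>, the gradient is \<open>s h\<^sup>s\<^sup>-\<^sup>1 m D (P\<^sup>T D)\<^sup>m\<^sup>-\<^sup>1\<close>, which gives (a). For (b), put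
  \<open>A = P\<^sup>T D\<close> and \<open>P'\<^sup>T D = Q \<Omega>\<close>. Diagonalizing \<open>\<Omega>\<close> and \<open>A\<close> reduces
  \<open>m tr (Q \<Omega> A\<^sup>m\<^sup>-\<^sup>1) \<le> tr (\<Omega>\<^sup>m) + (m - 1) tr (A\<^sup>m)\<close> to Young's inequality for the eigenvalues. A
  second application of Young's inequality, \<open>s h\<^sup>s\<^sup>-\<^sup>1 w \<le> w\<^sup>s + (s - 1) h\<^sup>s\<close> with \<open>w = tr (\<Omega>\<^sup>m)\<close>, finishes
  the proof. The spectral theorem and the polar decomposition are obtained by maximizing traces over
  the compact orthogonal group and comparing the maximizer with its products with reflections.
\<close>

section \<open>Trace and matrix product\<close>

text \<open>The Frobenius inner product: trace pairings become inner products, for which continuity,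
  norms and gradients are at hand.\<close>

lemma trace_transpose_mult: "trace (transpose X ** Y) = X \<bullet> (Y :: real ^ 'k ^ 'n)"
  by (simp add: trace_def transpose_def matrix_matrix_mult_def inner_vec_def)
     (rule sum.swap)

lemma trace_scaleR: "trace (c *\<^sub>R A) = c * trace (A :: real ^ 'k ^ 'k)"
  by (simp add: trace_def sum_distrib_left)

lemma bounded_bilinear_matrix_mult:
  "bounded_bilinear ((**) :: real ^ 'l ^ 'n \<Rightarrow> real ^ 'k ^ 'l \<Rightarrow> real ^ 'k ^ 'n)"
  by (rule bilinear_conv_bounded_bilinear[THEN iffD1])
     (auto simp: bilinear_def linear_iff matrix_matrix_mult_def vec_eq_iff algebra_simps
        sum.distrib sum_distrib_left)

lemma bounded_linear_transpose: "bounded_linear (transpose :: real ^ 'k ^ 'n \<Rightarrow> real ^ 'n ^ 'k)"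
  by (rule linear_conv_bounded_linear[THEN iffD1]) (auto simp: linear_iff transpose_def vec_eq_iff)

lemma bounded_linear_trace: "bounded_linear (trace :: real ^ 'k ^ 'k \<Rightarrow> real)"
  by (rule linear_conv_bounded_linear[THEN iffD1])
     (auto simp: linear_iff trace_def sum.distrib sum_distrib_left)

lemmas matrix_scaleR_left = bounded_bilinear.scaleR_left[OF bounded_bilinear_matrix_mult]
lemmas matrix_scaleR_right = bounded_bilinear.scaleR_right[OF bounded_bilinear_matrix_mult]
lemmas matrix_add_left = bounded_bilinear.add_left[OF bounded_bilinear_matrix_mult]
lemmas matrix_add_right = bounded_bilinear.add_right[OF bounded_bilinear_matrix_mult]
lemmas matrix_diff_left = bounded_bilinear.diff_left[OF bounded_bilinear_matrix_mult]
lemmas matrix_diff_right = bounded_bilinear.diff_right[OF bounded_bilinear_matrix_mult]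

lemma stiefel_square_iff: "Q \<in> stiefel \<longleftrightarrow> orthogonal_matrix (Q :: real ^ 'k ^ 'k)"
  by (simp add: stiefel_def orthogonal_matrix)

section \<open>Reflections and maximization over the orthogonal group\<close>

definition outer :: "real ^ 'n \<Rightarrow> real ^ 'k \<Rightarrow> real ^ 'k ^ 'n" where
  "outer u v = (\<chi> i j. u $ i * v $ j)"

lemma outer_mult: "outer u v ** C = outer u (transpose C *v v)"
  by (simp add: outer_def matrix_matrix_mult_def matrix_vector_mult_def transpose_def vec_eq_iff
      sum_distrib_left mult_ac del: transpose_matrix_vector)

lemma trace_outer: "trace (outer u v) = u \<bullet> v"
  by (simp add: outer_def trace_def inner_vec_def)

lemma outer_outer: "outer u v ** outer w z = (v \<bullet> w) *\<^sub>R outer u z"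
  by (simp add: outer_def matrix_matrix_mult_def vec_eq_iff inner_vec_def
      sum_distrib_left sum_distrib_right mult_ac)

lemma inner_matrix_vector_left: "(transpose C *v u) \<bullet> v = u \<bullet> (C *v (v :: real ^ 'k))"
  by (metis dot_lmul_matrix transpose_matrix_vector)

lemma trace_outer_mult: "trace (outer u v ** C) = v \<bullet> (C *v u)"
  by (metis inner_commute inner_matrix_vector_left outer_mult trace_outer)

text \<open>Not normalized: this is \<open>x \<bullet> x\<close> times the reflection in the hyperplane orthogonal to \<open>x\<close>, so
  that the inequalities below are polynomial in \<open>x\<close>.\<close>

definition reflection :: "real ^ 'k \<Rightarrow> real ^ 'k ^ 'k" where
  "reflection x = (x \<bullet> x) *\<^sub>R mat 1 - 2 *\<^sub>R outer x x"

lemma transpose_reflection: "transpose (reflection x) = reflection x"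
  by (simp add: reflection_def vec_eq_iff transpose_def outer_def mat_def mult_ac)

lemma reflection_square: "reflection x ** reflection x = (x \<bullet> x)\<^sup>2 *\<^sub>R mat 1"
  by (simp add: reflection_def matrix_diff_left matrix_diff_right matrix_scaleR_left
      matrix_scaleR_right outer_outer vec_eq_iff power2_eq_square algebra_simps)

lemma trace_reflection_mult: "trace (reflection x ** C) = (x \<bullet> x) * trace C - 2 * (x \<bullet> (C *v x))"
  by (simp add: reflection_def matrix_diff_left matrix_scaleR_left trace_sub trace_scaleR
      trace_outer_mult)

lemma orthogonal_reflection:
  assumes "x \<noteq> 0"
  shows "orthogonal_matrix ((1 / (x \<bullet> x)) *\<^sub>R reflection x)"
  using assms
  by (simp add: orthogonal_matrix transpose_scalar transpose_reflection matrix_scaleR_left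
      matrix_scaleR_right reflection_square power2_eq_square)

text \<open>A product of two reflections is, up to scale, a rotation in the plane of
  \<open>x\<close> and \<open>y\<close>. It is the perturbation that tests the symmetry of
  \<open>C\<close> in the polar decomposition.\<close>

lemma trace_two_reflections:
  "trace (reflection x ** reflection y ** C) =
     (x \<bullet> x) * (y \<bullet> y) * trace C - 2 * (y \<bullet> y) * (x \<bullet> (C *v x)) - 2 * (x \<bullet> x) * (y \<bullet> (C *v y))
     + 4 * (x \<bullet> y) * (y \<bullet> (C *v x))"
  by (simp add: reflection_def matrix_add_left matrix_diff_left matrix_diff_right matrix_scaleR_left
      matrix_scaleR_right outer_outer trace_add trace_sub trace_scaleR trace_outer_mult algebra_simps)

text \<open>Conjugation by a reflection is the perturbation used for diagonalization; the formula
  makes the perturbed trace explicit in quadratic forms.\<close>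

lemma trace_conj_reflection:
  "trace (W ** (reflection x ** C ** reflection x)) =
     (x \<bullet> x)\<^sup>2 * trace (W ** C) - 2 * (x \<bullet> x) * (x \<bullet> ((W ** C) *v x))
     - 2 * (x \<bullet> x) * (x \<bullet> ((C ** W) *v x)) + 4 * (x \<bullet> (W *v x)) * (x \<bullet> (C *v x))"
proof -
  have "outer x x ** C ** outer x x = (x \<bullet> (C *v x)) *\<^sub>R outer x x"
    by (simp only: outer_mult[of x x C] outer_outer inner_matrix_vector_left)
  moreover have "trace (W ** outer x x) = x \<bullet> (W *v x)"
    "trace (W ** (C ** outer x x)) = x \<bullet> ((W ** C) *v x)"
    "trace (W ** (outer x x ** C)) = x \<bullet> ((C ** W) *v x)"
    by (metis matrix_mul_assoc trace_mul_sym trace_outer_mult)+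
  ultimately show ?thesis
    by (simp add: reflection_def matrix_add_left matrix_add_right matrix_diff_left matrix_diff_right
        matrix_scaleR_left matrix_scaleR_right trace_add trace_sub trace_scaleR algebra_simps
        power2_eq_square)
qed

text \<open>Closed, as the solution set of a continuous equation, and bounded, since the squared
  norm of \<open>Q\<close> is the trace of the identity.\<close>

lemma compact_orthogonal_matrices: "compact {Q :: real ^ 'k ^ 'k. orthogonal_matrix Q}"
proof -
  have "closed {Q :: real ^ 'k ^ 'k. transpose Q ** Q = mat 1}"
    by (intro closed_Collect_eq bounded_bilinear.continuous_on[OF bounded_bilinear_matrix_mult]
        bounded_linear.continuous_on[OF bounded_linear_transpose] continuous_intros)
  moreover have "norm Q \<le> sqrt (CARD('k))" if "transpose Q ** Q = mat 1" for Q :: "real ^ 'k ^ 'k"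
    using that trace_transpose_mult[of Q Q] by (simp add: trace_I norm_eq_sqrt_inner)
  ultimately show ?thesis
    by (auto simp: orthogonal_matrix compact_eq_bounded_closed bounded_iff)
qed

text \<open>Compactness gives a maximizer. Since the orthogonal matrices form a group, all
  competitors may be written as perturbations \<open>Q ** R\<close>.\<close>

lemma orthogonal_maximizer:
  fixes f :: "real ^ 'k ^ 'k \<Rightarrow> real"
  assumes "continuous_on UNIV f"
  obtains Q where "orthogonal_matrix Q" "\<And>R. orthogonal_matrix R \<Longrightarrow> f (Q ** R) \<le> f Q"
proof -
  have "{Q :: real ^ 'k ^ 'k. orthogonal_matrix Q} \<noteq> {}"
    using orthogonal_matrix_id by blast
  from continuous_attains_sup[OF compact_orthogonal_matrices this] assms continuous_on_subset
  obtain Q where "orthogonal_matrix Q" "\<And>R. orthogonal_matrix R \<Longrightarrow> f R \<le> f Q"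
    by (metis mem_Collect_eq subset_UNIV)
  then show thesis
    using that orthogonal_matrix_mul by blast
qed

text \<open>The polynomial vanishes at 0 and so has a maximum there; its derivative at 0 is
  \<open>a\<close>. Degree 4 suffices for the reflections along
  \<open>axis i 1 + t *\<^sub>R axis j 1\<close>.\<close>

lemma linear_coeff_eq_0:
  fixes a b c d :: real
  assumes "\<And>t. a * t + b * t^2 + c * t^3 + d * t^4 \<le> 0"
  shows "a = 0"
proof -
  let ?g = "\<lambda>t. a * t + b * t^2 + c * t^3 + d * t^4"
  have "(?g has_real_derivative a) (at 0)"
    by (auto intro!: derivative_eq_intros)
  then show ?thesis
    by (rule DERIV_local_max[where d = 1]) (use assms in auto)
qed

lemma inner_matrix_axis: "axis i 1 \<bullet> (C *v axis j 1) = (C :: real ^ 'k ^ 'k) $ i $ j"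
  by (simp add: inner_axis' matrix_vector_mult_basis column_def)

lemma inner_matrix_axis_sum:
  fixes C :: "real ^ 'k ^ 'k" and t :: real and i j :: 'k
  defines "x \<equiv> axis i 1 + t *\<^sub>R axis j 1"
  shows "x \<bullet> (C *v x) = C $ i $ i + t * (C $ i $ j + C $ j $ i) + t\<^sup>2 * C $ j $ j"
  by (simp add: x_def inner_add_left inner_add_right matrix_vector_right_distrib
      matrix_vector_mult_scaleR inner_matrix_axis algebra_simps power2_eq_square)

section \<open>Polar decomposition\<close>

text \<open>Take \<open>Q\<close> maximizing the trace of \<open>transpose Q ** B\<close> and let
  \<open>C\<close> be this product. Comparison with one reflection makes the quadratic form of
  \<open>C\<close> nonnegative, and comparison with two makes \<open>C\<close> symmetric.\<close>

lemma polar_factor_exists: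
  fixes B :: "real ^ 'k ^ 'k"
  shows "\<exists>Q. polar_factor Q B"
proof -
  have "continuous_on UNIV (\<lambda>Q. Q \<bullet> B)"
    by (intro continuous_intros)
  then obtain Q where Q: "orthogonal_matrix Q"
    and max: "\<And>R. orthogonal_matrix R \<Longrightarrow> (Q ** R) \<bullet> B \<le> Q \<bullet> B"
    using orthogonal_maximizer by blast
  define C where "C = transpose Q ** B"
  have max': "trace (R ** C) \<le> trace C" if "orthogonal_matrix R" for R
    using max[of "transpose R"] that
    by (simp add: trace_transpose_mult[symmetric] matrix_transpose_mul C_def matrix_mul_assoc)
  have psd: "0 \<le> x \<bullet> (C *v x)" for x
  proof (cases "x = 0")
    case False
    then show ?thesis
      using max'[OF orthogonal_reflection[OF False]]
      by (simp add: matrix_scaleR_left trace_scaleR trace_reflection_mult field_simps)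
  qed simp
  have "C $ j $ i = C $ i $ j" if "i \<noteq> j" for i j
  proof -
    \<comment> \<open>The two reflections below, along \<open>x\<close> and \<open>y\<close>, cancel
      at \<open>t = 0\<close>, so the change of the trace has no constant term. Its linear
      coefficient is the antisymmetric part of \<open>C\<close>, which must therefore
      vanish.\<close>
    have "2 * (C $ j $ i - C $ i $ j) * t + (- 2 * (C $ i $ i + C $ j $ j)) * t^2 + 0 * t^3 + 0 * t^4
        \<le> 0" for t
    proof -
      define x where "x = (axis i 1 :: real ^ 'k)"
      define y where "y = axis i 1 + t *\<^sub>R (axis j 1 :: real ^ 'k)"
      have inners: "x \<bullet> x = 1" "x \<bullet> y = 1" "y \<bullet> y = 1 + t\<^sup>2"
        using that by (auto simp: x_def y_def inner_axis_axis algebra_simps power2_eq_square)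
      have pos: "1 + t\<^sup>2 > 0"
        by (smt (verit) zero_le_power2)
      then have "x \<noteq> 0" "y \<noteq> 0"
        using inners by auto
      then have "trace (reflection x ** reflection y ** C) / (1 + t\<^sup>2) \<le> trace C"
        using max'[OF orthogonal_matrix_mul[OF orthogonal_reflection orthogonal_reflection], of x y]
        by (simp add: inners matrix_scaleR_left matrix_scaleR_right trace_scaleR)
      then have "trace (reflection x ** reflection y ** C) \<le> (1 + t\<^sup>2) * trace C"
        using pos by (simp add: field_simps)
      moreover have "x \<bullet> (C *v x) = C $ i $ i" "y \<bullet> (C *v x) = C $ i $ i + t * C $ j $ i"
        by (simp_all add: x_def y_def inner_matrix_axis inner_add_left)
      moreover have "y \<bullet> (C *v y) = C $ i $ i + t * (C $ i $ j + C $ j $ i) + t\<^sup>2 * C $ j $ j"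
        unfolding y_def by (rule inner_matrix_axis_sum)
      ultimately show ?thesis
        by (simp add: trace_two_reflections inners algebra_simps)
    qed
    from linear_coeff_eq_0[OF this] show ?thesis
      by simp
  qed
  then have "transpose C = C"
    unfolding transpose_def vec_eq_iff by (auto, metis)
  with psd have "psd C"
    by (simp add: psd_def)
  moreover have "B = Q ** C"
    using Q by (simp add: C_def matrix_mul_assoc orthogonal_matrix_def)
  ultimately show ?thesis
    using Q unfolding polar_factor_def stiefel_square_iff by blast
qed

section \<open>Diagonal matrices and the spectral theorem\<close>

definition diag :: "('k \<Rightarrow> real) \<Rightarrow> real ^ 'k ^ 'k" where
  "diag a = (\<chi> i j. if i = j then a i else 0)"

lemma diag_mult: "diag a ** C = (\<chi> i j. a i * C $ i $ j)"
  by (simp add: diag_def matrix_matrix_mult_def vec_eq_iff if_distrib if_distribR cong: if_cong)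

lemma mult_diag: "C ** diag a = (\<chi> i j. C $ i $ j * a j)"
  by (simp add: diag_def matrix_matrix_mult_def vec_eq_iff if_distrib if_distribR cong: if_cong)

lemma diag_mult_diag: "diag a ** diag b = diag (\<lambda>i. a i * b i)"
  by (simp add: diag_mult) (simp add: diag_def vec_eq_iff)

lemma trace_diag: "trace (diag a) = (\<Sum>i\<in>UNIV. a i)"
  by (simp add: trace_def diag_def)

text \<open>A maximizer of \<open>tr (W V\<^sup>T A V)\<close>, where \<open>W\<close> is diagonal with distinct entries, diagonalizes \<open>A\<close>.\<close>

lemma symmetric_diagonalization:
  fixes A :: "real ^ 'k ^ 'k"
  assumes sym: "transpose A = A"
  obtains V a where "orthogonal_matrix V" "A = V ** diag a ** transpose V"
proof -
  obtain w :: "'k \<Rightarrow> nat" where w: "inj w"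
    using finite_imp_inj_to_nat_seg[of "UNIV :: 'k set"] by auto
  define W where "W = diag (\<lambda>i. real (w i))"
  have "continuous_on UNIV (\<lambda>V. trace (W ** (transpose V ** A ** V)))"
    by (intro bounded_linear.continuous_on[OF bounded_linear_trace]
        bounded_bilinear.continuous_on[OF bounded_bilinear_matrix_mult]
        bounded_linear.continuous_on[OF bounded_linear_transpose] continuous_intros)
  then obtain V where V: "orthogonal_matrix V" and max: "\<And>R. orthogonal_matrix R \<Longrightarrow>
      trace (W ** (transpose (V ** R) ** A ** (V ** R))) \<le> trace (W ** (transpose V ** A ** V))"
    using orthogonal_maximizer by blast
  define C where "C = transpose V ** A ** V"
  have max': "trace (W ** (transpose R ** C ** R)) \<le> trace (W ** C)" if "orthogonal_matrix R" for R
    using max[OF that] by (simp add: C_def matrix_transpose_mul matrix_mul_assoc)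
  have "transpose C = C"
    by (simp add: C_def matrix_transpose_mul sym matrix_mul_assoc)
  then have C_sym: "C $ i $ j = C $ j $ i" for i j
    by (metis transpose_def vec_lambda_beta)
  have off_diag: "C $ i $ j = 0" if "i \<noteq> j" for i j
  proof -
    let ?w = "\<lambda>i. real (w i)"
    \<comment> \<open>\<open>b\<close> and \<open>c\<close> are merely the coefficients of
      \<open>t^2\<close> and \<open>t^3\<close> in the change of the trace under the reflection
      along \<open>axis i 1 + t *\<^sub>R axis j 1\<close>. The linear coefficient is
      \<open>4 * (?w i - ?w j) * C $ i $ j\<close>, and distinct weights force the entry of
      \<open>C\<close> to be 0.\<close>
    define b where "b = 4 * (?w i * C $ j $ j + ?w j * C $ i $ i - ?w j * C $ j $ j - ?w i * C $ i $ i)"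
    define c where "c = 4 * (?w j - ?w i) * C $ i $ j"
    have "4 * (?w i - ?w j) * C $ i $ j * t + b * t^2 + c * t^3 + 0 * t^4 \<le> 0" for t
    proof -
      define x where "x = axis i 1 + t *\<^sub>R (axis j 1 :: real ^ 'k)"
      have xx: "x \<bullet> x = 1 + t\<^sup>2"
        using that by (auto simp: x_def inner_axis_axis algebra_simps power2_eq_square)
      have pos: "1 + t\<^sup>2 > 0"
        by (smt (verit) zero_le_power2)
      then have "x \<noteq> 0"
        using xx by auto
      then have "trace (W ** (reflection x ** C ** reflection x)) / (1 + t\<^sup>2)\<^sup>2 \<le> trace (W ** C)"
        using max'[OF orthogonal_reflection, of x]
        by (simp add: xx transpose_scalar transpose_reflection matrix_scaleR_left
            matrix_scaleR_right trace_scaleR power2_eq_square)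
      then have "trace (W ** (reflection x ** C ** reflection x)) \<le> (1 + t\<^sup>2)\<^sup>2 * trace (W ** C)"
        using pos by (simp add: field_simps)
      moreover have "x \<bullet> (M *v x) = M $ i $ i + t * (M $ i $ j + M $ j $ i) + t\<^sup>2 * M $ j $ j" for M
        unfolding x_def by (rule inner_matrix_axis_sum)
      moreover have "W $ i $ j = 0" "W $ j $ i = 0" "W $ i $ i = ?w i" "W $ j $ j = ?w j"
        using that by (auto simp: W_def diag_def)
      moreover have "(W ** C) $ p $ q = ?w p * C $ p $ q" "(C ** W) $ p $ q = C $ p $ q * ?w q" for p q
        by (simp_all add: W_def diag_mult mult_diag)
      ultimately show ?thesis
        by (simp add: trace_conj_reflection xx C_sym[of j i] b_def c_def)
          (simp add: algebra_simps power2_eq_square power3_eq_cube)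
    qed
    from linear_coeff_eq_0[OF this] show ?thesis
      using w that by (auto dest: injD)
  qed
  define a where "a i = C $ i $ i" for i
  have "C = diag a"
    using off_diag by (auto simp: diag_def a_def vec_eq_iff)
  moreover have "A = V ** C ** transpose V"
    using V unfolding C_def orthogonal_matrix_def
    by (metis matrix_mul_assoc matrix_mul_lid matrix_mul_rid)
  ultimately show thesis
    using that V by blast
qed

section \<open>The trace inequality\<close>

text \<open>Each eigenvalue is the value of the quadratic form of \<open>A\<close> at a column of
  \<open>V\<close>.\<close>

lemma psd_diagonalization:
  fixes A :: "real ^ 'k ^ 'k"
  assumes "psd A"
  obtains V a where "orthogonal_matrix V" "A = V ** diag a ** transpose V" "\<And>i. 0 \<le> a i"
proof -
  obtain V a where V: "orthogonal_matrix V" and A: "A = V ** diag a ** transpose V"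
    using assms symmetric_diagonalization unfolding psd_def by blast
  have "0 \<le> a i" for i
  proof -
    have diag: "diag a = transpose V ** A ** V"
      using V unfolding A orthogonal_matrix_def
      by (metis matrix_mul_assoc matrix_mul_lid matrix_mul_rid)
    have "a i = axis i 1 \<bullet> (diag a *v axis i 1)"
      by (simp only: inner_matrix_axis) (simp add: diag_def)
    also have "\<dots> = (V *v axis i 1) \<bullet> (A *v (V *v axis i 1))"
      unfolding diag by (metis inner_matrix_vector_left matrix_vector_mul_assoc transpose_transpose)
    finally show ?thesis
      using assms by (simp add: psd_def)
  qed
  then show thesis
    using that V A by blast
qed

lemma matpow_conj_diag:
  fixes V :: "real ^ 'k ^ 'k"
  assumes "orthogonal_matrix V"
  shows "matpow (V ** diag a ** transpose V) n = V ** diag (\<lambda>i. a i ^ n) ** transpose V"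
proof (induction n)
  case 0
  have "diag (\<lambda>i :: 'k. 1) = mat 1"
    by (simp add: diag_def mat_def)
  then show ?case
    using assms by (simp add: orthogonal_matrix_def)
next
  case (Suc n)
  have "V ** diag a ** transpose V ** (V ** diag (\<lambda>i. a i ^ n) ** transpose V) =
      V ** (diag a ** (transpose V ** V) ** diag (\<lambda>i. a i ^ n)) ** transpose V"
    by (simp add: matrix_mul_assoc)
  then show ?case
    using Suc assms by (simp add: orthogonal_matrix diag_mult_diag)
qed

lemma trace_conj_orthogonal:
  "orthogonal_matrix V \<Longrightarrow> trace (V ** C ** transpose V) = trace (C :: real ^ 'k ^ 'k)"
  by (metis matrix_mul_assoc matrix_mul_lid orthogonal_matrix trace_mul_sym)

lemma trace_matpow_psd_nonneg:
  assumes "psd A"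
  shows "0 \<le> trace (matpow A n)"
proof -
  obtain V a where V: "orthogonal_matrix V" and A: "A = V ** diag a ** transpose V"
    and a: "\<And>i. 0 \<le> a i"
    using psd_diagonalization[OF assms] by blast
  show ?thesis
    unfolding A matpow_conj_diag[OF V] trace_conj_orthogonal[OF V] trace_diag
    by (intro sum_nonneg zero_le_power a)
qed

lemma orthogonal_row_sum:
  assumes "orthogonal_matrix (X :: real ^ 'k ^ 'k)"
  shows "(\<Sum>j\<in>UNIV. (X $ i $ j)\<^sup>2) = 1"
proof -
  have "(X ** transpose X) $ i $ i = 1"
    using assms by (simp add: orthogonal_matrix_def mat_def)
  then show ?thesis
    by (simp add: matrix_matrix_mult_def transpose_def power2_eq_square)
qed

lemma orthogonal_column_sum:
  assumes "orthogonal_matrix (X :: real ^ 'k ^ 'k)"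
  shows "(\<Sum>i\<in>UNIV. (X $ i $ j)\<^sup>2) = 1"
proof -
  have "orthogonal_matrix (transpose X)"
    using assms by simp
  from orthogonal_row_sum[OF this] show ?thesis
    by (simp add: transpose_def)
qed

text \<open>The inequality of means for one \<open>x ^ Suc n\<close> and \<open>n\<close> copies of
  \<open>y ^ Suc n\<close>. The induction step multiplies by \<open>y\<close> and adds
  \<open>(x - y) * (x ^ Suc n - y ^ Suc n)\<close>, whose factors have the same sign.\<close>

lemma power_young:
  fixes x y :: real
  assumes "0 \<le> x" "0 \<le> y"
  shows "real (Suc n) * (x * y ^ n) \<le> x ^ Suc n + real n * y ^ Suc n"
proof (induction n)
  case (Suc n)
  have "y * (real (Suc n) * (x * y ^ n)) \<le> y * (x ^ Suc n + real n * y ^ Suc n)"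
    using Suc assms(2) by (rule mult_left_mono)
  moreover have "0 \<le> (x - y) * (x ^ Suc n - y ^ Suc n)"
  proof (cases "x \<le> y")
    case True
    then show ?thesis
      using power_mono[OF True assms(1), of "Suc n"] by (intro mult_nonpos_nonpos) auto
  next
    case False
    then show ?thesis
      using power_mono[of y x "Suc n"] assms(2) by (intro mult_nonneg_nonneg) auto
  qed
  ultimately show ?case
    by (simp add: algebra_simps)
qed simp

text \<open>In eigenbases of \<open>\<Omega>\<close> and \<open>A\<close> the left-hand trace is a sum of \<open>x\<^sub>i y\<^sub>j\<^sup>n\<close> over the eigenvalues
  whose weights are products of entries of two orthogonal matrices; by the inequality of means, they
  are dominated by the doubly stochastic matrix \<open>c\<close>.\<close>

lemma trace_young:
  fixes Q \<Omega> A :: "real ^ 'k ^ 'k"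
  assumes Q: "orthogonal_matrix Q" and "psd \<Omega>" "psd A"
  shows "real (Suc n) * trace (Q ** \<Omega> ** matpow A n)
    \<le> trace (matpow \<Omega> (Suc n)) + real n * trace (matpow A (Suc n))"
proof -
  obtain U x where U: "orthogonal_matrix U" and \<Omega>: "\<Omega> = U ** diag x ** transpose U"
    and x: "\<And>i. 0 \<le> x i"
    using psd_diagonalization[OF \<open>psd \<Omega>\<close>] by blast
  obtain V y where V: "orthogonal_matrix V" and A: "A = V ** diag y ** transpose V"
    and y: "\<And>i. 0 \<le> y i"
    using psd_diagonalization[OF \<open>psd A\<close>] by blast
  define X where "X = transpose V ** Q ** U"
  define Y where "Y = transpose U ** V"
  define c where "c i j = ((X $ j $ i)\<^sup>2 + (Y $ i $ j)\<^sup>2) / 2" for i j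
  have "orthogonal_matrix X" "orthogonal_matrix Y"
    by (simp_all add: X_def Y_def orthogonal_matrix_mul Q U V)
  then have c_row: "(\<Sum>j\<in>UNIV. c i j) = 1" and c_column: "(\<Sum>i\<in>UNIV. c i j) = 1" for i j
    by (simp_all add: c_def sum_divide_distrib[symmetric] sum.distrib orthogonal_row_sum
        orthogonal_column_sum)
  have "trace (Q ** \<Omega> ** matpow A n) =
      trace ((Q ** U ** diag x ** Y ** diag (\<lambda>i. y i ^ n)) ** transpose V)"
    unfolding A \<Omega> matpow_conj_diag[OF V] Y_def by (simp add: matrix_mul_assoc)
  \<comment> \<open>Cyclicity moves \<open>transpose V\<close> to the front, where it completes
    \<open>X\<close>.\<close>
  also have "\<dots> = trace ((X ** diag x) ** (Y ** diag (\<lambda>i. y i ^ n)))"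
    by (subst trace_mul_sym) (simp add: X_def matrix_mul_assoc)
  also have "\<dots> = (\<Sum>j\<in>UNIV. \<Sum>i\<in>UNIV. X $ j $ i * Y $ i $ j * (x i * y j ^ n))"
    unfolding mult_diag by (simp add: trace_def matrix_matrix_mult_def mult_ac)
  also have "\<dots> \<le> (\<Sum>j\<in>UNIV. \<Sum>i\<in>UNIV. c i j * (x i * y j ^ n))"
  proof (intro sum_mono mult_right_mono)
    show "X $ j $ i * Y $ i $ j \<le> c i j" for i j
      using sum_squares_bound[of "X $ j $ i" "Y $ i $ j"] by (simp add: c_def)
  qed (use x y in auto)
  finally have "real (Suc n) * trace (Q ** \<Omega> ** matpow A n)
      \<le> real (Suc n) * (\<Sum>j\<in>UNIV. \<Sum>i\<in>UNIV. c i j * (x i * y j ^ n))"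
    by (rule mult_left_mono) simp
  also have "\<dots> = (\<Sum>j\<in>UNIV. \<Sum>i\<in>UNIV. c i j * (real (Suc n) * (x i * y j ^ n)))"
    by (simp only: sum_distrib_left mult.left_commute)
  also have "\<dots> \<le> (\<Sum>j\<in>UNIV. \<Sum>i\<in>UNIV. c i j * (x i ^ Suc n + real n * y j ^ Suc n))"
    by (intro sum_mono mult_left_mono power_young x y) (simp add: c_def)
  also have "\<dots> = (\<Sum>j\<in>UNIV. \<Sum>i\<in>UNIV. c i j * x i ^ Suc n)
      + (\<Sum>j\<in>UNIV. \<Sum>i\<in>UNIV. c i j * (real n * y j ^ Suc n))"
    by (simp only: distrib_left sum.distrib)
  also have "(\<Sum>j\<in>UNIV. \<Sum>i\<in>UNIV. c i j * x i ^ Suc n) = (\<Sum>i\<in>UNIV. x i ^ Suc n)"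
    by (subst sum.swap) (simp only: sum_distrib_right[symmetric] c_row mult_1)
  also have "(\<Sum>j\<in>UNIV. \<Sum>i\<in>UNIV. c i j * (real n * y j ^ Suc n)) = real n * (\<Sum>j\<in>UNIV. y j ^ Suc n)"
    by (simp only: sum_distrib_right[symmetric] sum_distrib_left c_column mult_1)
  finally show ?thesis
    unfolding A \<Omega> matpow_conj_diag[OF V] matpow_conj_diag[OF U] trace_conj_orthogonal[OF U]
      trace_conj_orthogonal[OF V] trace_diag .
qed

section \<open>The gradient\<close>

text \<open>The chain rule along the line through \<open>P\<close> in the direction of a matrix
  unit: the inner product of \<open>G\<close> with that unit is an entry of
  \<open>G\<close>.\<close>

lemma euclidean_grad_eq:
  assumes "(f has_derivative (\<lambda>H. G \<bullet> H)) (at P)"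
  shows "euclidean_grad f P = G"
proof -
  have "deriv (\<lambda>t. f (P + t *\<^sub>R axis i (axis j 1))) 0 = G $ i $ j" for i j
  proof (rule DERIV_imp_deriv)
    let ?E = "axis i (axis j 1)"
    have "((\<lambda>t. P + t *\<^sub>R ?E) has_derivative (\<lambda>t. t *\<^sub>R ?E)) (at 0)"
      by (auto intro!: derivative_eq_intros)
    then have "((\<lambda>t. f (P + t *\<^sub>R ?E)) has_derivative (\<lambda>t. G \<bullet> (t *\<^sub>R ?E))) (at 0)"
      by (rule has_derivative_compose) (use assms in simp)
    then show "((\<lambda>t. f (P + t *\<^sub>R ?E)) has_real_derivative G $ i $ j) (at 0)"
      by (simp add: has_field_derivative_def inner_axis mult_commute_abs)
  qed
  then show ?thesis
    by (simp add: euclidean_grad_def vec_eq_iff)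
qed

text \<open>The derivative of \<open>A\<^sup>m\<close> along \<open>H\<close> is \<open>\<Sum>i<m. A\<^sup>i H A\<^sup>m\<^sup>-\<^sup>1\<^sup>-\<^sup>i\<close>. Under the trace, multiplied by
  a matrix that commutes with \<open>A\<close>, the summands all agree.\<close>

lemma has_derivative_matpow:
  fixes f :: "'a::real_normed_vector \<Rightarrow> real ^ 'k ^ 'k"
  assumes f: "(f has_derivative f') (at P)"
  shows "\<exists>F. ((\<lambda>P. matpow (f P) m) has_derivative F) (at P) \<and>
    (\<forall>C H. C ** f P = f P ** C \<longrightarrow>
       trace (C ** F H) = real m * trace (C ** matpow (f P) (m - 1) ** f' H))"
proof (induction m)
  case 0
  have "trace (0 :: real ^ 'k ^ 'k) = 0"
    by (simp add: trace_def)
  moreover have "((\<lambda>P. matpow (f P) 0) has_derivative (\<lambda>_. 0)) (at P)"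
    by simp
  ultimately show ?case
    by (intro exI[of _ "\<lambda>_. 0"])
       (simp add: bounded_bilinear.zero_right[OF bounded_bilinear_matrix_mult])
next
  case (Suc m)
  let ?A = "f P"
  from Suc obtain F where F: "((\<lambda>P. matpow (f P) m) has_derivative F) (at P)"
    and tr: "\<And>C H. C ** ?A = ?A ** C \<Longrightarrow>
      trace (C ** F H) = real m * trace (C ** matpow ?A (m - 1) ** f' H)"
    by blast
  let ?F = "\<lambda>H. ?A ** F H + f' H ** matpow ?A m"
  have "((\<lambda>P. matpow (f P) (Suc m)) has_derivative ?F) (at P)"
    using bounded_bilinear.FDERIV[OF bounded_bilinear_matrix_mult f F] by simp
  moreover have "trace (C ** ?F H) = real (Suc m) * trace (C ** matpow ?A m ** f' H)"
    if C: "C ** ?A = ?A ** C" for C H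
  proof -
    have "matpow ?A m ** C = C ** matpow ?A m"
      using C by (induction m) (auto simp: matrix_mul_assoc, metis matrix_mul_assoc)
    then have "trace (C ** (f' H ** matpow ?A m)) = trace (C ** matpow ?A m ** f' H)"
      by (metis matrix_mul_assoc trace_mul_sym)
    \<comment> \<open>The induction hypothesis is applied to \<open>C ** ?A\<close>, which also
      commutes with \<open>?A\<close>; this is why \<open>C\<close> is kept general. At
      \<open>m = 0\<close>, where \<open>m - 1\<close> truncates, the factor \<open>m\<close> makes
      both sides 0.\<close>
    moreover have "trace (C ** (?A ** F H)) = real m * trace (C ** matpow ?A m ** f' H)"
    proof -
      have "C ** ?A ** ?A = ?A ** (C ** ?A)"
        using C by (metis matrix_mul_assoc)
      from tr[OF this, of H] show ?thesis
        by (cases m) (simp_all add: matrix_mul_assoc)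
    qed
    ultimately show ?thesis
      by (simp add: matrix_add_ldistrib trace_add algebra_simps)
  qed
  ultimately show ?case
    by auto
qed

lemma has_derivative_trace_matpow:
  fixes D P :: "real ^ 'k ^ 'n"
  shows "((\<lambda>P. trace (matpow (transpose P ** D) m)) has_derivative
    (\<lambda>H. (real m *\<^sub>R (D ** matpow (transpose P ** D) (m - 1))) \<bullet> H)) (at P)"
proof -
  let ?A = "transpose P ** D"
  have "((\<lambda>P. transpose P ** D) has_derivative (\<lambda>H. transpose H ** D)) (at P)"
    by (intro bounded_linear.has_derivative[OF bounded_linear_compose[OF
          bounded_bilinear.bounded_linear_left[OF bounded_bilinear_matrix_mult]
          bounded_linear_transpose]] has_derivative_ident)
  from has_derivative_matpow[OF this, of m] obtain F where
    F: "((\<lambda>P. matpow (transpose P ** D) m) has_derivative F) (at P)"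
    and tr: "\<And>C H. C ** ?A = ?A ** C \<Longrightarrow>
      trace (C ** F H) = real m * trace (C ** matpow ?A (m - 1) ** (transpose H ** D))"
    by blast
  have "trace (F H) = (real m *\<^sub>R (D ** matpow ?A (m - 1))) \<bullet> H" for H
  proof -
    \<comment> \<open>The identity is the commuting matrix chosen here.\<close>
    have "trace (F H) = real m * trace (matpow ?A (m - 1) ** (transpose H ** D))"
      using tr[of "mat 1" H] by simp
    also have "\<dots> = real m * trace (transpose H ** (D ** matpow ?A (m - 1)))"
      by (metis matrix_mul_assoc trace_mul_sym)
    finally show ?thesis
      by (simp add: trace_transpose_mult inner_commute)
  qed
  then show ?thesis
    using bounded_linear.has_derivative[OF bounded_linear_trace F] by simp
qed

text \<open>Three cases: the usual rule for \<open>x > 0\<close>, a bound on the difference quotient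
  at 0, and an integer exponent for \<open>x < 0\<close>. The identity for \<open>x * d\<close>
  covers all of them and serves part (a); the formula with \<open>powr\<close> serves part (b),
  where the trace is nonnegative.\<close>

lemma has_derivative_real_pow:
  assumes s: "1 < s" and x: "x \<in> real_pow_dom s"
  obtains d where "((\<lambda>x. real_pow x s) has_real_derivative d) (at x)"
    "x * d = s * real_pow x s" "0 \<le> x \<Longrightarrow> d = s * x powr (s - 1)"
proof -
  consider "0 < x" | "x = 0" | "x < 0"
    by linarith
  then show thesis
  proof cases
    case 1
    have "((\<lambda>x. x powr s) has_real_derivative s * x powr (s - 1)) (at x)"
      using 1 by (rule has_real_derivative_powr)
    then have "((\<lambda>x. real_pow x s) has_real_derivative s * x powr (s - 1)) (at x)"
      by (rule has_field_derivative_transform_within_open[where S = "{0<..}"])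
         (use 1 in \<open>auto simp: real_pow_def\<close>)
    moreover have "x * x powr (s - 1) = x powr s"
      using 1 by (simp add: powr_mult_base)
    ultimately show thesis
      using that[of "s * x powr (s - 1)"] 1 by (simp add: real_pow_def)
  next
    case 2
    \<comment> \<open>For negative \<open>h\<close> the extension is 0 or an integer power, so the
      bound holds on both sides of 0. As \<open>s > 1\<close>, the difference quotient then tends to
      0.\<close>
    have "\<bar>real_pow h s\<bar> \<le> \<bar>h\<bar> powr s" for h
    proof (cases "0 \<le> h \<or> s \<notin> \<int>")
      case True
      then show ?thesis
        by (auto simp: real_pow_def)
    next
      case False
      then have "\<bar>h\<bar> powr s = \<bar>h\<bar> powr of_int \<lfloor>s\<rfloor>" "h < 0"
        by (auto elim: Ints_cases)
      then show ?thesis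
        using False by (simp add: real_pow_def power_int_abs powr_real_of_int')
    qed
    then have bound: "norm (real_pow h s / h) \<le> \<bar>h\<bar> powr (s - 1)" if "h \<noteq> 0" for h
      using that by (simp add: powr_diff divide_right_mono)
    have "((\<lambda>h :: real. \<bar>h\<bar> powr (s - 1)) \<longlongrightarrow> \<bar>0\<bar> powr (s - 1)) (at 0)"
      using s by (intro tendsto_intros tendsto_powr') auto
    then have lim: "((\<lambda>h :: real. \<bar>h\<bar> powr (s - 1)) \<longlongrightarrow> 0) (at 0)"
      by simp
    have "\<forall>\<^sub>F h in at 0. norm (real_pow h s / h) \<le> \<bar>h\<bar> powr (s - 1)"
      unfolding eventually_at_filter using bound by (auto intro: always_eventually)
    then have "((\<lambda>h. real_pow h s / h) \<longlongrightarrow> 0) (at 0)"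
      using lim by (rule Lim_null_comparison)
    then have "((\<lambda>x. real_pow x s) has_real_derivative 0) (at x)"
      unfolding 2 DERIV_def by (simp add: real_pow_def)
    then show thesis
      by (rule that) (auto simp: 2 real_pow_def)
  next
    case 3
    then have "s \<in> \<int>"
      using x by (simp add: real_pow_dom_def)
    with s obtain n where n: "s = real n"
      by (auto elim!: Ints_cases simp: of_nat_nat intro!: that[of "nat \<lfloor>s\<rfloor>"])
    have real_pow: "real_pow y s = y ^ n" if "y < 0" for y
      using that by (simp add: real_pow_def n)
    have "((\<lambda>x. x ^ n) has_real_derivative real n * x ^ (n - 1)) (at x)"
      by (auto intro!: derivative_eq_intros)
    then have "((\<lambda>x. real_pow x s) has_real_derivative real n * x ^ (n - 1)) (at x)"
      by (rule has_field_derivative_transform_within_open[where S = "{..<0}"])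
         (use 3 real_pow in auto)
    moreover have "x * x ^ (n - 1) = x ^ n"
      using s n by (cases n) auto
    ultimately show thesis
      using that[of "real n * x ^ (n - 1)"] 3 real_pow[OF 3] by (simp add: n)
  qed
qed

text \<open>The chain rule, with \<open>d\<close> the derivative of the outer power at
  \<open>h\<close>. It is only characterized, as its formula with \<open>powr\<close> is restricted
  to \<open>0 \<le> h\<close>.\<close>

lemma tr_pow_gradient:
  fixes D P :: "real ^ 'k ^ 'n" and m :: nat
  defines "h \<equiv> trace (matpow (transpose P ** D) m)"
  assumes s: "1 < s" and P: "P \<in> tr_pow_dom D m s"
  obtains d where "tr_pow D m s differentiable (at P)"
    "\<And>X. trace (transpose X ** euclidean_grad (tr_pow D m s) P) =
       d * real m * trace (transpose X ** D ** matpow (transpose P ** D) (m - 1))"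
    "h * d = s * tr_pow D m s P" "0 \<le> h \<Longrightarrow> d = s * h powr (s - 1)"
proof -
  have "h \<in> real_pow_dom s"
    using P by (simp add: tr_pow_dom_def h_def)
  with s obtain d where d: "((\<lambda>x. real_pow x s) has_real_derivative d) (at h)"
    "h * d = s * real_pow h s" "0 \<le> h \<Longrightarrow> d = s * h powr (s - 1)"
    using has_derivative_real_pow by blast
  let ?G = "real m *\<^sub>R (D ** matpow (transpose P ** D) (m - 1))"
  have "(tr_pow D m s has_derivative (\<lambda>H. d * (?G \<bullet> H))) (at P)"
    using has_derivative_compose[OF has_derivative_trace_matpow[of D m P],
        of "\<lambda>x. real_pow x s" "(*) d"] d(1)
    by (simp add: has_field_derivative_def h_def tr_pow_def[abs_def])
  then have deriv: "(tr_pow D m s has_derivative (\<lambda>H. (d *\<^sub>R ?G) \<bullet> H)) (at P)"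
    by (simp only: inner_scaleR_left)
  show thesis
  proof (rule that)
    show "tr_pow D m s differentiable (at P)"
      using deriv by (rule differentiableI)
    show "trace (transpose X ** euclidean_grad (tr_pow D m s) P) =
       d * real m * trace (transpose X ** D ** matpow (transpose P ** D) (m - 1))" for X
      unfolding euclidean_grad_eq[OF deriv]
      by (simp add: matrix_scaleR_right trace_scaleR matrix_mul_assoc)
    show "h * d = s * tr_pow D m s P"
      using d(2) by (simp add: tr_pow_def h_def)
  qed (fact d(3))
qed

section \<open>The atomic function conditions\<close>

lemma mat_Dplus_subset_tr_pow_dom: "mat_Dplus D \<subseteq> tr_pow_dom D m s"
  by (auto simp: mat_Dplus_def tr_pow_dom_def real_pow_dom_def trace_matpow_psd_nonneg)

text \<open>Euler's identity for a function homogeneous of degree \<open>s * m\<close>: at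
  \<open>X = P\<close> the matrix product closes up to the \<open>m\<close>-th power of
  \<open>transpose P ** D\<close>.\<close>

lemma trace_grad_self:
  assumes "1 \<le> m" "1 < s" "P \<in> tr_pow_dom D m s"
  shows "trace (transpose P ** euclidean_grad (tr_pow D m s) P) = s * real m * tr_pow D m s P"
proof -
  let ?A = "transpose P ** D"
  obtain d where grad: "\<And>X. trace (transpose X ** euclidean_grad (tr_pow D m s) P) =
       d * real m * trace (transpose X ** D ** matpow ?A (m - 1))"
    and d: "trace (matpow ?A m) * d = s * tr_pow D m s P"
    using tr_pow_gradient[OF assms(2,3)] by metis
  have "?A ** matpow ?A (m - 1) = matpow ?A m"
    using assms(1) by (cases m) auto
  then show ?thesis
    unfolding grad using d by (simp add: mult_ac)
qed

text \<open>Young's inequality for \<open>w\<close> and \<open>h powr (s - 1)\<close> with conjugate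
  exponents \<open>s\<close> and \<open>q\<close>, multiplied by \<open>s\<close>. Here
  \<open>(s - 1) * q = s\<close> and \<open>s / q = s - 1\<close>.\<close>

lemma powr_young:
  fixes h w s :: real
  assumes "0 \<le> h" "0 \<le> w" "1 < s"
  shows "s * h powr (s - 1) * w \<le> w powr s + (s - 1) * h powr s"
proof -
  define q where "q = s / (s - 1)"
  have q: "1 < q" "1 / s + 1 / q = 1"
    using assms(3) by (auto simp: q_def field_simps)
  have "w * h powr (s - 1) \<le> w powr s / s + (h powr (s - 1)) powr q / q"
    using q assms by (intro Youngs_inequality) auto
  also have "(h powr (s - 1)) powr q = h powr s"
    using assms by (simp add: powr_powr q_def)
  finally have "s * (w * h powr (s - 1)) \<le> s * (w powr s / s + h powr s / q)"
    using assms by (intro mult_left_mono) auto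
  also have "\<dots> = w powr s + (s - 1) * h powr s"
    using assms by (simp add: q_def field_simps)
  finally show ?thesis
    by (simp add: mult_ac)
qed

text \<open>Multiplying \<open>transpose P' ** D = Q ** \<Omega>\<close> by
  \<open>transpose Q\<close> identifies the semidefinite factor with
  \<open>transpose (P' ** Q) ** D\<close>. Thus \<open>P' ** Q\<close> lies in
  \<open>mat_Dplus D\<close>.\<close>

lemma polar_factor_aligned:
  assumes "polar_factor Q (transpose P' ** D)"
  obtains "orthogonal_matrix Q" "psd (transpose (P' ** Q) ** D)"
    "transpose P' ** D = Q ** (transpose (P' ** Q) ** D)"
proof -
  obtain \<Omega> where Q: "orthogonal_matrix Q" and \<Omega>: "psd \<Omega>" "transpose P' ** D = Q ** \<Omega>"
    using assms unfolding polar_factor_def stiefel_square_iff by blast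
  have "transpose (P' ** Q) ** D = transpose Q ** (transpose P' ** D)"
    by (simp add: matrix_transpose_mul matrix_mul_assoc)
  also have "\<dots> = \<Omega>"
    using Q by (simp add: \<Omega> matrix_mul_assoc orthogonal_matrix)
  finally show thesis
    using that Q \<Omega> by simp
qed

lemma trace_grad_le:
  fixes D P P' :: "real ^ 'k ^ 'n"
  assumes m: "1 \<le> m" and s: "1 < s" and P: "P \<in> mat_Dplus D"
    and Q: "polar_factor Q (transpose P' ** D)"
  shows "trace (transpose P' ** euclidean_grad (tr_pow D m s) P)
    \<le> tr_pow D m s (P' ** Q) + (s * real m - 1) * tr_pow D m s P"
proof -
  let ?A = "transpose P ** D" and ?\<Omega> = "transpose (P' ** Q) ** D"
  define h where "h = trace (matpow ?A m)"
  define w where "w = trace (matpow ?\<Omega> m)"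
  obtain n where n: "m = Suc n"
    using m by (cases m) auto
  have A: "psd ?A"
    using P by (simp add: mat_Dplus_def)
  from Q obtain orth: "orthogonal_matrix Q" and \<Omega>: "psd ?\<Omega>" and P': "transpose P' ** D = Q ** ?\<Omega>"
    by (rule polar_factor_aligned)
  have h: "0 \<le> h" and w: "0 \<le> w"
    using A \<Omega> by (simp_all add: h_def w_def trace_matpow_psd_nonneg)
  have pow: "tr_pow D m s P = h powr s" "tr_pow D m s (P' ** Q) = w powr s"
    using h w by (simp_all add: tr_pow_def real_pow_def h_def w_def)
  have "P \<in> tr_pow_dom D m s"
    using P mat_Dplus_subset_tr_pow_dom by blast
  then obtain d where grad: "\<And>X. trace (transpose X ** euclidean_grad (tr_pow D m s) P) =
       d * real m * trace (transpose X ** D ** matpow ?A (m - 1))"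
    and d: "d = s * h powr (s - 1)"
    using tr_pow_gradient[OF s, of P D m] h unfolding h_def by metis
  have "trace (transpose P' ** euclidean_grad (tr_pow D m s) P)
      = d * (real (Suc n) * trace (Q ** ?\<Omega> ** matpow ?A n))"
    unfolding grad P' by (simp add: n)
  \<comment> \<open>The matrix Young inequality may be multiplied by \<open>d\<close>, which is
    nonnegative.\<close>
  also have "\<dots> \<le> d * (w + real n * h)"
    unfolding h_def w_def n using trace_young[OF orth \<Omega> A] s by (intro mult_left_mono) (auto simp: d)
  also have "\<dots> = s * h powr (s - 1) * w + s * real n * (h * h powr (s - 1))"
    by (simp add: d algebra_simps)
  also have "h * h powr (s - 1) = h powr s"
    using h by (simp add: powr_mult_base)
  \<comment> \<open>With \<open>m = n + 1\<close>, the coefficients of \<open>h powr s\<close> add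
    up to \<open>s * n + (s - 1) = s * m - 1\<close>.\<close>
  also have "s * h powr (s - 1) * w \<le> w powr s + (s - 1) * h powr s"
    using h w s by (rule powr_young)
  finally show ?thesis
    unfolding pow by (simp add: n algebra_simps)
qed

theorem corollary4p1:
  fixes D :: "real ^ 'k ^ 'n" and m :: nat and s :: real
  assumes "CARD('k) \<le> CARD('n)" and "1 \<le> m" and "1 < s"
  shows "(\<forall>P \<in> tr_pow_dom D m s.
            trace (transpose P ** euclidean_grad (tr_pow D m s) P) = s * real m * tr_pow D m s P)
       \<and> (\<forall>P \<in> mat_Dplus D. \<forall>P' Q. polar_factor Q (transpose P' ** D) \<longrightarrow>
            P' ** Q \<in> mat_Dplus D \<and>
            trace (transpose P' ** euclidean_grad (tr_pow D m s) P)
              \<le> tr_pow D m s (P' ** Q) + (s * real m - 1) * tr_pow D m s P)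
       \<and> NPDo_conditions (tr_pow_dom D m s) (tr_pow D m s) (stiefel_Dplus D) 1 (s * real m - 1)
       \<and> NPDo_atomic (tr_pow_dom D m s) (tr_pow D m s)"
proof -
  have a: "trace (transpose P ** euclidean_grad (tr_pow D m s) P) = s * real m * tr_pow D m s P"
    if "P \<in> tr_pow_dom D m s" for P
    using assms(2,3) that by (rule trace_grad_self)
  have b: "P' ** Q \<in> mat_Dplus D" "trace (transpose P' ** euclidean_grad (tr_pow D m s) P)
      \<le> tr_pow D m s (P' ** Q) + (s * real m - 1) * tr_pow D m s P"
    if "P \<in> mat_Dplus D" "polar_factor Q (transpose P' ** D)" for P P' Q
    using polar_factor_aligned[OF that(2)] trace_grad_le[OF assms(2,3) that]
    by (auto simp: mat_Dplus_def)
  have Dplus: "stiefel_Dplus D = stiefel \<inter> mat_Dplus D"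
    by (auto simp: stiefel_Dplus_def mat_Dplus_def)
  \<comment> \<open>This is \<open>0 \<le> \<beta>\<close>; moreover
    \<open>\<alpha> + \<beta> = s * m\<close> is the constant of part (a).\<close>
  have "1 \<le> s * real m"
    using mult_mono[of 1 s 1 "real m"] assms by simp
  moreover have "tr_pow D m s differentiable (at P)" if "P \<in> tr_pow_dom D m s" for P
    using tr_pow_gradient[OF assms(3) that] by metis
  \<comment> \<open>Condition (2): any polar factor of \<open>transpose P' ** D\<close> is a
    witness, since right multiplication by an orthogonal matrix preserves orthonormal
    columns.\<close>
  moreover have "\<exists>Q\<in>stiefel. P' ** Q \<in> stiefel_Dplus D \<and>
      trace (transpose P' ** euclidean_grad (tr_pow D m s) P)
        \<le> 1 * tr_pow D m s (P' ** Q) + (s * real m - 1) * tr_pow D m s P"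
    if P: "P \<in> stiefel_Dplus D" and P': "P' \<in> stiefel" for P P'
  proof -
    obtain Q where Q: "polar_factor Q (transpose P' ** D)"
      using polar_factor_exists by blast
    then have "Q \<in> stiefel"
      by (simp add: polar_factor_def)
    moreover from this have "P' ** Q \<in> stiefel"
      using P' by (simp add: stiefel_def matrix_transpose_mul)
        (metis matrix_mul_assoc matrix_mul_lid)
    ultimately show ?thesis
      using b[OF _ Q] P unfolding Dplus by auto
  qed
  ultimately have "NPDo_conditions (tr_pow_dom D m s) (tr_pow D m s) (stiefel_Dplus D) 1
      (s * real m - 1)"
    unfolding NPDo_conditions_def using a mat_Dplus_subset_tr_pow_dom[of D m s]
    by (auto simp: Dplus)
  then show ?thesis
    using a b unfolding NPDo_atomic_def by blast
qed

end
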